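(* Let $f\in\mathcal{HK}$, let $F$ be one of its primitives and let $x\in\mathbb{R}$. Then the function $y\mapsto \tau_xF(y)-F(y)$ is in $\mathcal{HK}$, and $$\|\tau_xF-F\|\leq \|f\|\,|x|.$$ This holds even though none of the primitives of $f$ need be in $\mathcal{HK}$: there exists $f\in\mathcal{HK}$ such that no primitive of $f$ is in $\mathcal{HK}$. In general, $\tau_xF-F$ need not be in $L^1(\mathbb{R})$: there exist $f\in\mathcal{HK}$, a primitive $F$ of $f$ and $x\in\mathbb{R}$ such that $\tau_xF-F\notin L^1(\mathbb{R})$. However, if $f\in L^1(\mathbb{R})$ then, for every primitive $F$ of $f$ and every $x\in\mathbb{R}$, $\tau_xF-F\in L^1(\mathbb{R})$ and $\|\tau_xF-F\|_1\leq \|f\|_1|x|$.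
   Context: $\mathcal{HK}$ denotes the set of functions $f:\mathbb{R}\to\mathbb{R}$ that are Henstock--Kurzweil integrable on the whole real line. The Alexiewicz norm of $f\in\mathcal{HK}$ is $\|f\|=\sup_I\left|\int_I f\right|$, where the supremum is over all intervals $I\subset\mathbb{R}$ (bounded or unbounded) and the integral is the Henstock--Kurzweil integral. A primitive of $f\in\mathcal{HK}$ is a function $F:\mathbb{R}\to\mathbb{R}$ of the form $F(y)=\int_{-\infty}^yf+c$ with $c\in\mathbb{R}$ a constant. For $x,y\in\mathbb{R}$, $\tau_xF(y)=F(y-x)$. $\|\cdot\|_1$ is the usual norm of $L^1(\mathbb{R})$. *)

theory Defs
  imports "HOL-Analysis.Analysis"
begin

text \<open>On the unbounded domain \<^term>\<open>UNIV :: real set\<close>, the library's gauge integral requires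
  integrability on all compact intervals \<open>[a, b]\<close> together with convergence as \<open>a\<close> tends to
  \<open>-\<infinity>\<close> and \<open>b\<close> to \<open>\<infinity>\<close> independently.  By Hake's theorem this is the Henstock--Kurzweil
  integral over the whole real line.\<close>

definition HK :: "(real \<Rightarrow> real) set" where
  "HK = {f. f integrable_on UNIV}"

text \<open>For \<^term>\<open>f \<in> HK\<close> the set of values below is bounded above, so the real-valued supremum
  is the genuine one; outside \<^term>\<open>HK\<close> the value carries no meaning.\<close>

definition alexiewicz_norm :: "(real \<Rightarrow> real) \<Rightarrow> real" where
  "alexiewicz_norm f = (SUP I\<in>{I. is_interval I}. \<bar>integral I f\<bar>)"

text \<open>Meaningful for \<^term>\<open>f \<in> HK\<close>, in particular for every Lebesgue integrable \<^term>\<open>f\<close>.\<close>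

definition primitive_of :: "(real \<Rightarrow> real) \<Rightarrow> (real \<Rightarrow> real) \<Rightarrow> bool" where
  "primitive_of F f \<longleftrightarrow> (\<exists>c. \<forall>y. F y = integral {..y} f + c)"

definition translate :: "real \<Rightarrow> (real \<Rightarrow> real) \<Rightarrow> real \<Rightarrow> real" where
  "translate x F = (\<lambda>y. F (y - x))"

definition L1 :: "(real \<Rightarrow> real) set" where
  "L1 = {f. integrable lebesgue f}"

definition L1_norm :: "(real \<Rightarrow> real) \<Rightarrow> real" where
  "L1_norm f = (LINT y|lebesgue. \<bar>f y\<bar>)"

end

theory Submission imports Defs begin

text \<open>Let \<open>F\<close> be a primitive of \<open>f\<close>.  It is continuous with finite limits at both ends, by Hake's
  theorem, and its increments are the integrals of \<open>f\<close> over intervals, hence bounded by the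
  Alexiewicz norm of \<open>f\<close>.  Let \<open>P\<close> be an antiderivative of \<open>F\<close>.  Then
  \<open>\<integral>\<^sub>a\<^sup>b (\<tau>\<^sub>x F - F) = (P (b - x) - P (a - x)) - (P b - P a)\<close>.
  As \<open>b\<close> tends to infinity, \<open>P (b - x) - P b\<close> converges to \<open>-x\<close> times the limit of \<open>F\<close>, and
  likewise for \<open>a\<close>; this gives integrability.  As a function of \<open>x\<close> the right-hand side vanishes at
  \<open>0\<close> and has derivative \<open>F (a - x) - F (b - x)\<close>, an increment of \<open>F\<close>; the mean value inequality
  gives the norm estimate (\<open>translation_difference_HK\<close>).

  If \<open>f\<close> is absolutely integrable, the same estimate is applied to \<open>\<bar>f\<bar>\<close>.  Its primitive \<open>A\<close> is
  monotone, so \<open>\<tau>\<^sub>x A - A\<close> has constant sign and its Alexiewicz and \<open>L\<^sup>1\<close> norms agree, while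
  \<open>\<bar>\<tau>\<^sub>x F - F\<bar> \<le> \<bar>\<tau>\<^sub>x A - A\<bar>\<close> (\<open>translation_difference_of_L1_primitive\<close>).

  For the first counterexample, an integrable function with a limit at an end of the line has limit
  \<open>0\<close> there, whereas the limits of a primitive of \<open>f\<close> differ by \<open>\<integral> f\<close>; so the indicator function
  of \<open>{0..1}\<close> works (\<open>primitive_notin_HK\<close>).  For the second, \<open>P y = cos (\<pi> y) y / (1 + y\<^sup>2)\<close>,
  \<open>F = P'\<close>, \<open>f = P''\<close> and \<open>x = 1\<close>: the integral of \<open>\<tau>\<^sub>1 F - F\<close> over
  \<open>{k..k + 1}\<close> is at least \<open>1 / (k + 1)\<close> in absolute value for every integer \<open>k \<ge> 1\<close>, and the
  harmonic series diverges.\<close>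

section \<open>Indefinite integrals on the line and Hake's theorem\<close>

text \<open>Everything below is phrased by increments on compact intervals, so that additive constants
  disappear: primitives of \<open>f\<close>, antiderivatives of \<open>f\<close> and the functions
  \<open>y \<mapsto> \<integral>\<^sub>0\<^sup>y f\<close> all qualify, and convergence at infinity is a separate question.\<close>
definition indefinite_integral :: "(real \<Rightarrow> real) \<Rightarrow> (real \<Rightarrow> real) \<Rightarrow> bool" where
  "indefinite_integral K f \<longleftrightarrow> (\<forall>a b. a \<le> b \<longrightarrow> (f has_integral (K b - K a)) {a..b})"

lemma indefinite_integralD:
  "indefinite_integral K f \<Longrightarrow> a \<le> b \<Longrightarrow> (f has_integral (K b - K a)) {a..b}"
  by (simp add: indefinite_integral_def)

lemma indefinite_integral_antiderivative:
  assumes "\<And>t. (P has_real_derivative p t) (at t)"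
  shows "indefinite_integral P p"
  unfolding indefinite_integral_def
  by (intro allI impI fundamental_theorem_of_calculus)
     (auto intro: has_field_derivative_at_within assms
           simp flip: has_real_derivative_iff_has_vector_derivative)

lemma ball_subset_Icc_iff:
  fixes a b B :: real
  assumes "B > 0"
  shows "ball 0 B \<subseteq> {a..b} \<longleftrightarrow> a \<le> - B \<and> B \<le> b"
proof -
  have "ball 0 B = {-B<..<B}" by (auto simp: dist_real_def)
  then show ?thesis using assms
    by (auto simp: greaterThanLessThan_subseteq_atLeastAtMost_iff)
qed

text \<open>One half of Hake's theorem on the line: the two limits replace the integral over an unbounded
  set, since the gauge integral over the line is by definition a limit over growing boxes.\<close>
lemma has_integral_UNIV_of_limits:
  assumes K: "indefinite_integral K f"
    and A: "(K \<longlongrightarrow> A) at_bot" and B: "(K \<longlongrightarrow> B) at_top"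
  shows "(f has_integral (B - A)) UNIV"
  unfolding has_integral_alt'
proof (intro conjI allI impI)
  fix a b :: real
  show "(\<lambda>x. if x \<in> UNIV then f x else 0) integrable_on cbox a b"
    using indefinite_integralD[OF K, of a b] by (cases "a \<le> b") (auto simp: has_integral_integrable)
next
  fix e :: real assume "e > 0"
  then have "\<forall>\<^sub>F t in at_bot. dist (K t) A < e/2" "\<forall>\<^sub>F t in at_top. dist (K t) B < e/2"
    using tendstoD[OF A, of "e/2"] tendstoD[OF B, of "e/2"] by simp_all
  then obtain M N where M: "\<And>t. t \<le> M \<Longrightarrow> dist (K t) A < e/2"
    and N: "\<And>t. t \<ge> N \<Longrightarrow> dist (K t) B < e/2"
    unfolding eventually_at_bot_linorder eventually_at_top_linorder by blast
  define R where "R = max 1 (max (-M) N)"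
  have R: "R > 0" "- R \<le> M" "N \<le> R" by (auto simp: R_def)
  show "\<exists>R>0. \<forall>a b. ball 0 R \<subseteq> cbox a b \<longrightarrow>
      norm (integral (cbox a b) (\<lambda>x. if x \<in> UNIV then f x else 0) - (B - A)) < e"
  proof (intro exI conjI allI impI)
    fix a b :: real assume "ball 0 R \<subseteq> cbox a b"
    then have ab: "a \<le> M" "N \<le> b" "a \<le> b"
      using R by (auto simp: ball_subset_Icc_iff)
    have "integral {a..b} f = K b - K a"
      using indefinite_integralD[OF K \<open>a \<le> b\<close>] by (rule integral_unique)
    then show "norm (integral (cbox a b) (\<lambda>x. if x \<in> UNIV then f x else 0) - (B - A)) < e"
      using M[OF ab(1)] N[OF ab(2)] by (simp add: dist_real_def abs_if split: if_splits)
  qed (rule R)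
qed

text \<open>Cutting \<open>f\<close> off at \<open>y\<close> freezes the indefinite integral from \<open>y\<close> on; this reduces
  half-lines to the whole line.\<close>
lemma indefinite_integral_restrict_atMost:
  assumes K: "indefinite_integral K f"
  shows "indefinite_integral (\<lambda>t. K (min t y)) (\<lambda>t. if t \<in> {..y} then f t else 0)"
  unfolding indefinite_integral_def
proof (intro allI impI)
  fix a b :: real assume ab: "a \<le> b"
  have "(f has_integral (K (min b y) - K (min a y))) ({..y} \<inter> {a..b})"
  proof (cases "a \<le> y")
    case True
    then have "{..y} \<inter> {a..b} = {a..min b y}" by auto
    then show ?thesis using indefinite_integralD[OF K, of a "min b y"] True ab by simp
  next
    case False
    then have "{..y} \<inter> {a..b} = {}" by auto
    then show ?thesis using False ab by simp
  qed
  then show "((\<lambda>t. if t \<in> {..y} then f t else 0) has_integral (K (min b y) - K (min a y))) {a..b}"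
    by (simp only: has_integral_restrict_Int)
qed

lemma has_integral_atMost_of_limit:
  assumes K: "indefinite_integral K f" and A: "(K \<longlongrightarrow> A) at_bot"
  shows "(f has_integral (K y - A)) {..y}"
proof -
  have "((\<lambda>t. K (min t y)) \<longlongrightarrow> A) at_bot"
    by (rule Lim_transform_eventually[OF A])
       (auto simp: eventually_at_bot_linorder intro!: exI[of _ y])
  moreover have "((\<lambda>t. K (min t y)) \<longlongrightarrow> K y) at_top"
    by (rule tendsto_eventually)
       (auto simp: eventually_at_top_linorder min_def intro!: exI[of _ y])
  ultimately have "((\<lambda>t. if t \<in> {..y} then f t else 0) has_integral (K y - A)) UNIV"
    by (rule has_integral_UNIV_of_limits[OF indefinite_integral_restrict_atMost[OF K]])
  then show ?thesis by (simp only: has_integral_restrict_UNIV)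
qed

lemma indefinite_integral_ex:
  assumes "\<And>a b. f integrable_on {a..b}"
  obtains K where "indefinite_integral K f"
proof
  let ?K = "\<lambda>y. integral {0..y} f - integral {y..0} f"
  show "indefinite_integral ?K f"
    unfolding indefinite_integral_def
  proof (intro allI impI)
    fix a b :: real assume ab: "a \<le> b"
    have comb: "integral {u..v} f + integral {v..w} f = integral {u..w} f" if "u \<le> v" "v \<le> w" for u v w
      using Henstock_Kurzweil_Integration.integral_combine[OF that] assms by blast
    have triv: "integral {u..v} f = 0" if "v \<le> u" for u v
      using that by (cases "u = v") auto
    have "integral {a..b} f = ?K b - ?K a"
      using comb[of a 0 b] comb[of 0 a b] comb[of a b 0] triv[of 0 a] triv[of a 0] triv[of b 0] triv[of 0 b] ab
      by linarith
    then show "(f has_integral (?K b - ?K a)) {a..b}"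
      using assms[of a b] by (simp add: has_integral_iff)
  qed
qed

lemma tendsto_ex_of_Cauchy:
  fixes K :: "real \<Rightarrow> real"
  assumes "F \<noteq> bot"
    and "\<And>e. e > 0 \<Longrightarrow> \<exists>S. eventually (\<lambda>t. t \<in> S) F \<and> (\<forall>s\<in>S. \<forall>t\<in>S. \<bar>K s - K t\<bar> < e)"
  obtains l where "(K \<longlongrightarrow> l) F"
proof -
  have "cauchy_filter (filtermap K F)"
    unfolding cauchy_filter_metric_filtermap
  proof (intro allI impI)
    fix e :: real assume "e > 0"
    then obtain S where "eventually (\<lambda>t. t \<in> S) F" "\<forall>s\<in>S. \<forall>t\<in>S. \<bar>K s - K t\<bar> < e"
      using assms(2) by blast
    then show "\<exists>P. eventually P F \<and> (\<forall>x y. P x \<and> P y \<longrightarrow> dist (K x) (K y) < e)"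
      by (intro exI[of _ "\<lambda>t. t \<in> S"]) (auto simp: dist_real_def)
  qed
  then obtain l where "filtermap K F \<le> nhds l"
    using cauchy_filter_complete_converges[of "filtermap K F" UNIV] complete_UNIV assms(1)
    by (auto simp: filtermap_bot_iff)
  then show ?thesis using that by (auto simp: filterlim_def)
qed

text \<open>The other half of Hake's theorem: fixing one endpoint far out, the integrals over large boxes
  being close to each other is the Cauchy condition for the other endpoint.\<close>
lemma indefinite_integral_limits:
  assumes f: "f integrable_on UNIV" and K: "indefinite_integral K f"
  obtains A B where "(K \<longlongrightarrow> A) at_bot" "(K \<longlongrightarrow> B) at_top"
proof -
  have *: "\<exists>R. \<forall>a b. a \<le> - R \<and> R \<le> b \<longrightarrow> a \<le> b \<and> \<bar>K b - K a - integral UNIV f\<bar> < e" if e: "e > 0" for e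
  proof -
    have "(f has_integral integral UNIV f) UNIV" using f by (simp add: has_integral_integral)
    then obtain R where R: "R > 0" and
      *: "\<And>a b. ball 0 R \<subseteq> cbox a b \<Longrightarrow> \<bar>integral (cbox a b) f - integral UNIV f\<bar> < e"
      using e unfolding has_integral_alt' by auto
    show ?thesis
    proof (intro exI allI impI)
      fix a b assume ab: "a \<le> - R \<and> R \<le> b"
      then have "a \<le> b" using R by linarith
      then have "integral {a..b} f = K b - K a"
        using indefinite_integralD[OF K] by (blast intro: integral_unique)
      then show "a \<le> b \<and> \<bar>K b - K a - integral UNIV f\<bar> < e"
        using *[of a b] ab R \<open>a \<le> b\<close> by (simp add: ball_subset_Icc_iff)
    qed
  qed
  have "\<exists>S. eventually (\<lambda>t. t \<in> S) at_top \<and> (\<forall>s\<in>S. \<forall>t\<in>S. \<bar>K s - K t\<bar> < e)" if e: "e > 0" for e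
  proof -
    obtain R where R: "\<forall>a b. a \<le> - R \<and> R \<le> b \<longrightarrow> a \<le> b \<and> \<bar>K b - K a - integral UNIV f\<bar> < e / 2"
      using *[OF half_gt_zero[OF e]] by (rule exE)
    have "\<bar>K s - K t\<bar> < e" if "s \<ge> R" "t \<ge> R" for s t
      using R[rule_format, of "-R" s] R[rule_format, of "-R" t] that by linarith
    then show ?thesis by (intro exI[of _ "{R..}"]) (auto simp: eventually_ge_at_top)
  qed
  then obtain B where B: "(K \<longlongrightarrow> B) at_top"
    using tendsto_ex_of_Cauchy[of at_top K] by (metis trivial_limit_at_top_linorder)
  have "\<exists>S. eventually (\<lambda>t. t \<in> S) at_bot \<and> (\<forall>s\<in>S. \<forall>t\<in>S. \<bar>K s - K t\<bar> < e)" if e: "e > 0" for e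
  proof -
    obtain R where R: "\<forall>a b. a \<le> - R \<and> R \<le> b \<longrightarrow> a \<le> b \<and> \<bar>K b - K a - integral UNIV f\<bar> < e / 2"
      using *[OF half_gt_zero[OF e]] by (rule exE)
    have "\<bar>K s - K t\<bar> < e" if "s \<le> -R" "t \<le> -R" for s t
      using R[rule_format, of s R] R[rule_format, of t R] that by linarith
    then show ?thesis by (intro exI[of _ "{..-R}"]) (auto simp: eventually_le_at_bot)
  qed
  then obtain A where A: "(K \<longlongrightarrow> A) at_bot"
    using tendsto_ex_of_Cauchy[of at_bot K] by (metis trivial_limit_at_bot_linorder)
  show ?thesis using A B that by blast
qed

lemma HK_indefinite_integral:
  assumes "f \<in> HK"
  obtains K A B where "indefinite_integral K f" "(K \<longlongrightarrow> A) at_bot" "(K \<longlongrightarrow> B) at_top"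
proof -
  have f: "f integrable_on UNIV" using assms by (simp add: HK_def)
  then have "f integrable_on {a..b}" for a b
    using integrable_on_subcbox[of f UNIV a b] by simp
  then obtain K where "indefinite_integral K f" by (rule indefinite_integral_ex)
  with indefinite_integral_limits[OF f] that show ?thesis by metis
qed

lemma isCont_indefinite_integral:
  assumes K: "indefinite_integral K f"
  shows "isCont K t"
proof -
  have int: "f integrable_on {t-1..t+1}"
    using indefinite_integralD[OF K, of "t-1" "t+1"] by (auto simp: has_integral_integrable)
  have "continuous_on {t-1..t+1} (\<lambda>s. K (t-1) + integral {t-1..s} f)"
    by (intro continuous_intros indefinite_integral_continuous_1 int)
  also have "?this \<longleftrightarrow> continuous_on {t-1..t+1} K"
    by (rule continuous_on_cong)
       (auto dest!: indefinite_integralD[OF K, THEN integral_unique])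
  finally show ?thesis
    by (rule continuous_on_interior) simp
qed

text \<open>The constant in the definition of a primitive is its limit at minus infinity, and the total
  integral is the difference of the limits.  Later arguments see a primitive only through this
  description.\<close>
lemma primitive_HK:
  assumes f: "f \<in> HK" and F: "primitive_of F f"
  obtains c where "indefinite_integral F f" "(F \<longlongrightarrow> c) at_bot"
    "(F \<longlongrightarrow> c + integral UNIV f) at_top"
proof -
  from f obtain K A B where K: "indefinite_integral K f"
    and AB: "(K \<longlongrightarrow> A) at_bot" "(K \<longlongrightarrow> B) at_top"
    by (rule HK_indefinite_integral)
  obtain c where c: "\<And>y. F y = integral {..y} f + c"
    using F by (auto simp: primitive_of_def)
  have F: "F = (\<lambda>y. K y - A + c)"
    by (simp add: fun_eq_iff c integral_unique[OF has_integral_atMost_of_limit[OF K AB(1)]])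
  have int: "integral UNIV f = B - A"
    by (rule integral_unique[OF has_integral_UNIV_of_limits[OF K AB]])
  have "indefinite_integral F f"
    using K by (simp add: F indefinite_integral_def)
  moreover have "(F \<longlongrightarrow> c) at_bot" "(F \<longlongrightarrow> c + integral UNIV f) at_top"
    unfolding F int by (auto intro!: tendsto_eq_intros AB)
  ultimately show ?thesis by (rule that)
qed

lemma primitive_of_indefinite_integral:
  assumes "indefinite_integral F f" "(F \<longlongrightarrow> c) at_bot"
  shows "primitive_of F f"
  unfolding primitive_of_def
  by (rule exI[of _ c]) (simp add: integral_unique[OF has_integral_atMost_of_limit[OF assms]])

section \<open>The Alexiewicz norm through increments of an indefinite integral\<close>

text \<open>Bounded intervals of any kind agree up to two points with compact ones, so they have the same
  integrals.\<close>
lemma bounded_interval_ae_Icc: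
  fixes S :: "real set"
  assumes "is_interval S" "bounded S"
  obtains p q where "p \<le> q" "negligible (S - {p..q})" "negligible ({p..q} - S)"
proof (cases "S = {}")
  case True
  then show ?thesis by (intro that[of 0 0]) auto
next
  case False
  have bdd: "bdd_above S" "bdd_below S"
    using assms(2) by (auto simp: bounded_imp_bdd_above bounded_imp_bdd_below)
  have sub: "S \<subseteq> {Inf S..Sup S}"
    using bdd by (auto intro: cInf_lower cSup_upper)
  have "{Inf S..Sup S} - S \<subseteq> {Inf S, Sup S}"
  proof
    fix t assume t: "t \<in> {Inf S..Sup S} - S"
    show "t \<in> {Inf S, Sup S}"
    proof (rule ccontr)
      assume "t \<notin> {Inf S, Sup S}"
      then have "Inf S < t" "t < Sup S" using t by auto
      then obtain u v where "u \<in> S" "u < t" "v \<in> S" "t < v"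
        using cInf_lessD[OF False] less_cSupD[OF False] by metis
      then have "t \<in> S" using assms(1) unfolding is_interval_1 by (meson less_imp_le)
      then show False using t by simp
    qed
  qed
  then have "negligible ({Inf S..Sup S} - S)"
    by (rule negligible_subset[rotated]) simp
  moreover have "Inf S \<le> Sup S" using sub False by fastforce
  moreover have "negligible (S - {Inf S..Sup S})" using sub by (simp add: Diff_eq_empty_iff[THEN iffD2])
  ultimately show ?thesis by (intro that)
qed

text \<open>The integral over any interval is a limit of integrals over bounded subintervals, whose values
  are increments.  If \<open>f\<close> fails to be integrable over \<open>I\<close>, the integral is \<open>0\<close> by convention.\<close>
lemma abs_integral_interval_le:
  assumes K: "indefinite_integral K f" and C: "\<And>a b. a \<le> b \<Longrightarrow> \<bar>K b - K a\<bar> \<le> C"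
    and I: "is_interval I"
  shows "\<bar>integral I f\<bar> \<le> C"
proof -
  have C0: "0 \<le> C" using C[of 0 0] by simp
  have bdd: "\<bar>integral S f\<bar> \<le> C" if "is_interval S" "bounded S" for S
  proof -
    from that obtain p q where pq: "p \<le> q" "negligible (S - {p..q})" "negligible ({p..q} - S)"
      by (rule bounded_interval_ae_Icc)
    then have "integral S f = integral {p..q} f"
      by (intro integral_spike_set negligible_subset[OF pq(2)] negligible_subset[OF pq(3)]) auto
    also have "\<dots> = K q - K p" by (rule integral_unique[OF indefinite_integralD[OF K pq(1)]])
    finally show ?thesis using C[OF pq(1)] by simp
  qed
  show ?thesis
  proof (cases "f integrable_on I")
    case False
    then show ?thesis using C0 by (simp add: not_integrable_integral)
  next
    case True
    show ?thesis
    proof (rule field_le_epsilon)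
      fix e :: real assume "e > 0"
      moreover have "(f has_integral integral I f) I" using True by (rule integrable_integral)
      ultimately obtain R where R: "R > 0" and
        *: "\<And>a b. ball 0 R \<subseteq> cbox a b \<Longrightarrow>
              \<bar>integral (cbox a b) (\<lambda>x. if x \<in> I then f x else 0) - integral I f\<bar> < e"
        unfolding has_integral_alt' by auto
      have "integral (cbox (-R) R) (\<lambda>x. if x \<in> I then f x else 0) = integral (I \<inter> cbox (-R) R) f"
        by (rule integral_restrict_Int)
      moreover have "\<bar>integral (I \<inter> cbox (-R) R) f\<bar> \<le> C"
        by (rule bdd) (use I in \<open>auto simp: is_interval_Int is_interval_cbox bounded_Int simp del: cbox_interval\<close>)
      ultimately show "\<bar>integral I f\<bar> \<le> C + e"
        using *[of "-R" R] R by (simp add: ball_subset_Icc_iff)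
    qed
  qed
qed

lemma alexiewicz_norm_le:
  assumes "indefinite_integral K f" "\<And>a b. a \<le> b \<Longrightarrow> \<bar>K b - K a\<bar> \<le> C"
  shows "alexiewicz_norm f \<le> C"
  unfolding alexiewicz_norm_def
proof (rule cSUP_least)
  show "{I :: real set. is_interval I} \<noteq> {}" using is_interval_empty by blast
qed (use abs_integral_interval_le[OF assms] in auto)

lemma bounded_of_limits:
  fixes K :: "real \<Rightarrow> real"
  assumes cont: "\<And>t. isCont K t" and A: "(K \<longlongrightarrow> A) at_bot" and B: "(K \<longlongrightarrow> B) at_top"
  obtains M where "\<And>t. \<bar>K t\<bar> \<le> M"
proof -
  have "\<forall>\<^sub>F t in at_bot. dist (K t) A < 1" "\<forall>\<^sub>F t in at_top. dist (K t) B < 1"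
    using A B by (auto intro: tendstoD)
  then obtain m n where m: "\<And>t. t \<le> m \<Longrightarrow> dist (K t) A < 1"
    and n: "\<And>t. t \<ge> n \<Longrightarrow> dist (K t) B < 1"
    unfolding eventually_at_bot_linorder eventually_at_top_linorder by blast
  have "bounded (K ` {m..n})"
    by (intro compact_imp_bounded compact_continuous_image continuous_at_imp_continuous_on ballI cont) auto
  then obtain M where "\<forall>t\<in>{m..n}. \<bar>K t\<bar> \<le> M"
    unfolding bounded_iff by auto
  then have M: "\<And>t. t \<in> {m..n} \<Longrightarrow> \<bar>K t\<bar> \<le> M" by blast
  have "\<bar>K t\<bar> \<le> \<bar>M\<bar> + \<bar>A\<bar> + \<bar>B\<bar> + 1" for t
  proof -
    consider "t \<le> m" | "t \<ge> n" | "t \<in> {m..n}" by fastforce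
    then show ?thesis
    proof cases
      case 1 then show ?thesis using m[of t] unfolding dist_real_def by linarith
    next
      case 2 then show ?thesis using n[of t] unfolding dist_real_def by linarith
    next
      case 3 then show ?thesis using M[of t] by linarith
    qed
  qed
  then show ?thesis by (rule that)
qed

text \<open>The supremum in the norm is over a bounded set because an indefinite integral is continuous with
  limits at both ends, hence bounded.\<close>
lemma integral_le_alexiewicz_norm:
  assumes f: "f \<in> HK" and I: "is_interval I"
  shows "\<bar>integral I f\<bar> \<le> alexiewicz_norm f"
proof -
  from f obtain K A B where K: "indefinite_integral K f"
    and AB: "(K \<longlongrightarrow> A) at_bot" "(K \<longlongrightarrow> B) at_top"
    by (rule HK_indefinite_integral)
  obtain M where M: "\<And>t. \<bar>K t\<bar> \<le> M"
    using bounded_of_limits[OF isCont_indefinite_integral[OF K] AB] by blast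
  have "\<bar>K b - K a\<bar> \<le> 2 * M" for a b using M[of a] M[of b] by linarith
  then have "bdd_above ((\<lambda>I. \<bar>integral I f\<bar>) ` {I. is_interval I})"
    by (intro bdd_aboveI2[of _ _ "2*M"] abs_integral_interval_le[OF K]) auto
  then show ?thesis
    unfolding alexiewicz_norm_def by (rule cSUP_upper[rotated]) (simp add: I)
qed

lemma increment_le_alexiewicz_norm:
  assumes K: "indefinite_integral K f" and f: "f \<in> HK"
  shows "\<bar>K b - K a\<bar> \<le> alexiewicz_norm f"
proof -
  have "\<bar>K v - K u\<bar> \<le> alexiewicz_norm f" if "u \<le> v" for u v
    using integral_le_alexiewicz_norm[OF f is_interval_cc, of u v]
      integral_unique[OF indefinite_integralD[OF K that]] by simp
  from this[of a b] this[of b a] show ?thesis by (cases "a \<le> b") (auto simp: abs_minus_commute)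
qed

section \<open>Translation differences\<close>

lemma increment_le_of_derivative_bound:
  fixes Q :: "real \<Rightarrow> real"
  assumes "\<And>t. (Q has_real_derivative q t) (at t)"
    and "\<And>t. t \<in> closed_segment u v \<Longrightarrow> \<bar>q t\<bar> \<le> C"
  shows "\<bar>Q u - Q v\<bar> \<le> C * \<bar>u - v\<bar>"
proof -
  have "norm (Q u - Q v) \<le> C * norm (u - v)"
    by (rule field_differentiable_bound[of "closed_segment u v" Q q])
       (simp_all add: assms has_field_derivative_at_within)
  then show ?thesis by simp
qed

lemma continuous_has_antiderivative:
  fixes F :: "real \<Rightarrow> real"
  assumes "\<And>t. isCont F t"
  obtains P where "\<And>t. (P has_real_derivative F t) (at t)"
  using einterval_antiderivative[of "-\<infinity>" "\<infinity>" F] assms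
  by (auto simp: has_real_derivative_iff_has_vector_derivative)

text \<open>By the mean value theorem the increment over a step \<open>-x\<close> is \<open>-x\<close> times a value of \<open>F\<close> at
  a point that moves off to infinity with \<open>t\<close>.\<close>
lemma tendsto_translation_increment:
  fixes F P :: "real \<Rightarrow> real"
  assumes P: "\<And>t. (P has_real_derivative F t) (at t)"
    and F: "(F \<longlongrightarrow> l) G" and G: "G = at_bot \<or> G = at_top"
  shows "((\<lambda>t. P (t - x) - P t) \<longlongrightarrow> - l * x) G"
proof (rule tendstoI)
  fix e :: real assume "e > 0"
  define d where "d = e / (\<bar>x\<bar> + 1)"
  have d: "d > 0" "d * \<bar>x\<bar> < e" using \<open>e > 0\<close> by (auto simp: d_def field_simps)
  have "\<forall>\<^sub>F t in G. \<forall>s\<in>closed_segment (t - x) t. \<bar>F s - l\<bar> \<le> d"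
    using G
  proof
    assume G: "G = at_bot"
    obtain N where N: "\<forall>s\<le>N. dist (F s) l < d"
      using tendstoD[OF F d(1)] unfolding G eventually_at_bot_linorder by (rule exE)
    have "\<bar>F s - l\<bar> \<le> d" if "t \<le> N - \<bar>x\<bar>" "s \<in> closed_segment (t - x) t" for t s
    proof -
      have "s \<le> N"
        using that by (cases "0 \<le> x") (auto simp: closed_segment_eq_real_ivl)
      with N have "dist (F s) l < d" by blast
      then show ?thesis by (simp add: dist_real_def)
    qed
    then show ?thesis unfolding G eventually_at_bot_linorder by blast
  next
    assume G: "G = at_top"
    obtain N where N: "\<forall>s\<ge>N. dist (F s) l < d"
      using tendstoD[OF F d(1)] unfolding G eventually_at_top_linorder by (rule exE)
    have "\<bar>F s - l\<bar> \<le> d" if "t \<ge> N + \<bar>x\<bar>" "s \<in> closed_segment (t - x) t" for t s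
    proof -
      have "s \<ge> N"
        using that by (cases "0 \<le> x") (auto simp: closed_segment_eq_real_ivl)
      with N have "dist (F s) l < d" by blast
      then show ?thesis by (simp add: dist_real_def)
    qed
    then show ?thesis unfolding G eventually_at_top_linorder by blast
  qed
  then show "\<forall>\<^sub>F t in G. dist (P (t - x) - P t) (- l * x) < e"
  proof (rule eventually_mono)
    fix t assume t: "\<forall>s\<in>closed_segment (t - x) t. \<bar>F s - l\<bar> \<le> d"
    have "\<bar>(P (t - x) - l * (t - x)) - (P t - l * t)\<bar> \<le> d * \<bar>(t - x) - t\<bar>"
      using t
      by (intro increment_le_of_derivative_bound[where q = "\<lambda>s. F s - l"])
         (auto intro!: derivative_eq_intros P)
    also have "\<dots> < e" using d by simp
    finally show "dist (P (t - x) - P t) (- l * x) < e"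
      by (simp add: dist_real_def algebra_simps)
  qed
qed

text \<open>The heart of the matter.  With \<open>P\<close> an antiderivative of \<open>F\<close>, the function
  \<open>W t = P (t - x) - P t\<close> is an indefinite integral of the translation difference.  It has limits
  at both ends because \<open>F\<close> has, although \<open>P\<close> itself usually diverges.  For fixed \<open>a\<close> and \<open>b\<close> the
  increment \<open>W b - W a\<close> vanishes at \<open>x = 0\<close> and changes with \<open>x\<close> at a rate that is an increment
  of \<open>F\<close>, so the mean value inequality bounds it by \<open>C * \<bar>x\<bar>\<close>, for either sign of \<open>x\<close>.\<close>
lemma translation_difference_HK:
  assumes F: "\<And>t. isCont F t" and A: "(F \<longlongrightarrow> A) at_bot" and B: "(F \<longlongrightarrow> B) at_top"
    and C: "\<And>a b. \<bar>F b - F a\<bar> \<le> C"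
  shows "(\<lambda>y. translate x F y - F y) \<in> HK"
    and "alexiewicz_norm (\<lambda>y. translate x F y - F y) \<le> C * \<bar>x\<bar>"
proof -
  obtain P where P: "\<And>t. (P has_real_derivative F t) (at t)"
    using continuous_has_antiderivative[of F] F by blast
  define W where "W t = P (t - x) - P t" for t
  have shift: "((\<lambda>s. P (s - x)) has_real_derivative F (t - x)) (at t)" for t
    using DERIV_shift[of P "F (t - x)" t "- x"] P[of "t - x"] by simp
  have W: "indefinite_integral W (\<lambda>y. translate x F y - F y)"
    unfolding W_def translate_def
    by (intro indefinite_integral_antiderivative DERIV_diff shift P)
  have "((\<lambda>y. translate x F y - F y) has_integral (- B * x - (- A * x))) UNIV"
    unfolding W_def
    by (intro has_integral_UNIV_of_limits[OF W[unfolded W_def]]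
          tendsto_translation_increment[OF P] A B) auto
  then show "(\<lambda>y. translate x F y - F y) \<in> HK"
    by (auto simp: HK_def has_integral_integrable)
  show "alexiewicz_norm (\<lambda>y. translate x F y - F y) \<le> C * \<bar>x\<bar>"
  proof (rule alexiewicz_norm_le[OF W])
    fix a b :: real
    have reflect: "((\<lambda>s. P (c - s)) has_real_derivative - F (c - t)) (at t)" for c t
    proof -
      have "((\<lambda>s. c - s) has_real_derivative - 1) (at t)"
        by (auto intro!: derivative_eq_intros)
      from DERIV_chain2[OF P this] show ?thesis by simp
    qed
    \<comment> \<open>The increment as a function of the shift: its derivative in \<open>t\<close> is \<open>F (a - t) - F (b - t)\<close>.\<close>
    have "\<bar>(P (b - x) - P (a - x)) - (P (b - 0) - P (a - 0))\<bar> \<le> C * \<bar>x - 0\<bar>"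
      by (rule increment_le_of_derivative_bound, (rule DERIV_diff reflect)+)
         (use C[of "a - t" "b - t" for t] in \<open>simp add: abs_minus_commute\<close>)
    then show "\<bar>W b - W a\<bar> \<le> C * \<bar>x\<bar>" by (simp add: W_def algebra_simps)
  qed
qed

lemma translation_difference_of_primitive:
  assumes f: "f \<in> HK" and F: "primitive_of F f"
  shows "(\<lambda>y. translate x F y - F y) \<in> HK"
    and "alexiewicz_norm (\<lambda>y. translate x F y - F y) \<le> alexiewicz_norm f * \<bar>x\<bar>"
proof -
  from f F obtain c where K: "indefinite_integral F f" and
    lim: "(F \<longlongrightarrow> c) at_bot" "(F \<longlongrightarrow> c + integral UNIV f) at_top"
    by (rule primitive_HK)
  note * = isCont_indefinite_integral[OF K] lim increment_le_alexiewicz_norm[OF K f]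
  show "(\<lambda>y. translate x F y - F y) \<in> HK"
    and "alexiewicz_norm (\<lambda>y. translate x F y - F y) \<le> alexiewicz_norm f * \<bar>x\<bar>"
    using translation_difference_HK[OF *] by auto
qed

section \<open>Integrable functions without integrable primitives\<close>

text \<open>The integral of \<open>F\<close> over an interval of length \<open>1\<close> moving to infinity tends to \<open>0\<close> by
  convergence of the integral, and to \<open>l\<close> by convergence of \<open>F\<close>.\<close>
lemma limit_of_HK_eq_0:
  assumes F: "F \<in> HK" and cont: "\<And>t. isCont F t"
    and lim: "(F \<longlongrightarrow> l) G" and G: "G = at_bot \<or> G = at_top"
  shows "l = 0"
proof -
  obtain P where P: "\<And>t. (P has_real_derivative F t) (at t)"
    using continuous_has_antiderivative[of F] cont by blast
  have "F integrable_on UNIV" using F by (simp add: HK_def)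
  then obtain A B where AB: "(P \<longlongrightarrow> A) at_bot" "(P \<longlongrightarrow> B) at_top"
    by (rule indefinite_integral_limits[OF _ indefinite_integral_antiderivative[OF P]])
  have top: "filterlim (\<lambda>t. t - 1 :: real) at_top at_top"
    using filterlim_tendsto_add_at_top[OF tendsto_const[of "-1::real"] filterlim_ident] by simp
  have bot: "filterlim (\<lambda>t. t - 1 :: real) at_bot at_bot"
    unfolding filterlim_at_bot_le[where c=0] eventually_at_bot_linorder
    by (metis diff_le_eq add_increasing2 zero_le_one)
  have "G \<noteq> bot"
    using G trivial_limit_at_bot_linorder trivial_limit_at_top_linorder by metis
  moreover have "((\<lambda>t. P (t - 1) - P t) \<longlongrightarrow> 0) G"
    using G tendsto_diff[OF filterlim_compose[OF AB(2) top] AB(2)]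
      tendsto_diff[OF filterlim_compose[OF AB(1) bot] AB(1)]
    by auto
  moreover have "((\<lambda>t. P (t - 1) - P t) \<longlongrightarrow> - l * 1) G"
    by (rule tendsto_translation_increment[OF P lim G])
  ultimately show "l = 0" using tendsto_unique by fastforce
qed

text \<open>The limits of a primitive at the two ends differ by the nonzero total integral, so not both are
  \<open>0\<close>.\<close>
lemma primitive_notin_HK:
  assumes f: "f \<in> HK" "integral UNIV f \<noteq> 0" and F: "primitive_of F f"
  shows "F \<notin> HK"
proof
  assume "F \<in> HK"
  from f(1) F obtain c where K: "indefinite_integral F f" and
    lim: "(F \<longlongrightarrow> c) at_bot" "(F \<longlongrightarrow> c + integral UNIV f) at_top"
    by (rule primitive_HK)
  have "c = 0" "c + integral UNIV f = 0"
    using limit_of_HK_eq_0[OF \<open>F \<in> HK\<close> isCont_indefinite_integral[OF K] lim(1)]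
      limit_of_HK_eq_0[OF \<open>F \<in> HK\<close> isCont_indefinite_integral[OF K] lim(2)] by blast+
  then show False using f(2) by simp
qed

lemma indicator_unit_interval:
  "(indicator {0..1} :: real \<Rightarrow> real) \<in> HK" "integral UNIV (indicator {0..1} :: real \<Rightarrow> real) = 1"
proof -
  have "((\<lambda>x. 1) has_integral (1::real)) {0..1::real}"
    using has_integral_const_real[of "1::real" 0 1] by simp
  then have "((indicator {0..1} :: real \<Rightarrow> real) has_integral 1) UNIV"
    unfolding indicator_def of_bool_def by (simp only: has_integral_restrict_UNIV)
  then show "(indicator {0..1} :: real \<Rightarrow> real) \<in> HK"
    "integral UNIV (indicator {0..1} :: real \<Rightarrow> real) = 1"
    by (auto simp: HK_def has_integral_iff)
qed

section \<open>Absolutely integrable functions\<close>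

lemma L1_iff_absolutely_integrable: "f \<in> L1 \<longleftrightarrow> f absolutely_integrable_on UNIV"
  by (simp add: L1_def set_integrable_def)

lemma L1_norm_eq: "f \<in> L1 \<Longrightarrow> L1_norm f = integral UNIV (\<lambda>y. \<bar>f y\<bar>)"
  using integral_lebesgue[of "\<lambda>y. \<bar>f y\<bar>"]
  by (simp add: L1_def L1_norm_def)

lemma HK_of_L1: "f \<in> L1 \<Longrightarrow> f \<in> HK" "f \<in> L1 \<Longrightarrow> (\<lambda>y. \<bar>f y\<bar>) \<in> HK"
  unfolding L1_iff_absolutely_integrable absolutely_integrable_on_def HK_def by auto

text \<open>A translation difference of a monotone function has constant sign, opposite to that of \<open>x\<close>.
  Hence its absolute value is integrable as soon as it is, with the same integral up to sign.\<close>
lemma translation_difference_of_mono: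
  assumes A: "mono A" and w: "(\<lambda>y. translate x A y - A y) \<in> HK"
  shows "(\<lambda>y. \<bar>translate x A y - A y\<bar>) \<in> HK"
    and "integral UNIV (\<lambda>y. \<bar>translate x A y - A y\<bar>) = \<bar>integral UNIV (\<lambda>y. translate x A y - A y)\<bar>"
proof -
  define w where "w = (\<lambda>y. translate x A y - A y)"
  \<comment> \<open>At \<open>x = 0\<close> the factor \<open>s\<close> vanishes, but so does \<open>w\<close>.\<close>
  define s where "s = - sgn x"
  have abs: "(\<lambda>y. \<bar>w y\<bar>) = (\<lambda>y. s * w y)"
    using monoD[OF A, of "y - x" y for y] monoD[OF A, of y "y - x" for y]
    by (auto simp: w_def s_def translate_def fun_eq_iff sgn_if)
  have "w integrable_on UNIV" using w by (simp add: HK_def w_def)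
  then have "((\<lambda>y. \<bar>w y\<bar>) has_integral s * integral UNIV w) UNIV"
    unfolding abs by (intro has_integral_mult_right integrable_integral)
  then have *: "(\<lambda>y. \<bar>w y\<bar>) integrable_on UNIV" "integral UNIV (\<lambda>y. \<bar>w y\<bar>) = s * integral UNIV w"
    by (auto simp: has_integral_iff)
  then show "(\<lambda>y. \<bar>translate x A y - A y\<bar>) \<in> HK" by (simp add: HK_def w_def)
  have "0 \<le> s * integral UNIV w" using integral_nonneg[OF *(1)] *(2) by simp
  moreover have "w = (\<lambda>_. 0)" if "x = 0" using that by (simp add: w_def translate_def)
  ultimately have "s * integral UNIV w = \<bar>integral UNIV w\<bar>"
    by (cases "x = 0") (auto simp: s_def sgn_if split: if_splits)
  with * show "integral UNIV (\<lambda>y. \<bar>translate x A y - A y\<bar>) = \<bar>integral UNIV (\<lambda>y. translate x A y - A y)\<bar>"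
    by (simp add: w_def)
qed

text \<open>The difference for \<open>F\<close> is dominated by the one for the monotone primitive \<open>A\<close> of \<open>\<bar>f\<bar>\<close>.  For
  \<open>A\<close> the Alexiewicz estimate already is an \<open>L\<^sup>1\<close> estimate, because of the constant sign; this
  takes the place of Fubini's theorem.\<close>
lemma translation_difference_of_L1_primitive:
  assumes f: "f \<in> L1" and F: "primitive_of F f"
  shows "(\<lambda>y. translate x F y - F y) \<in> L1"
    and "L1_norm (\<lambda>y. translate x F y - F y) \<le> L1_norm f * \<bar>x\<bar>"
proof -
  define A where "A y = integral {..y} (\<lambda>t. \<bar>f t\<bar>)" for y
  have primA: "primitive_of A (\<lambda>t. \<bar>f t\<bar>)" by (auto simp: primitive_of_def A_def)
  have KF: "indefinite_integral F f"
    by (rule primitive_HK[OF HK_of_L1(1)[OF f] F])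
  obtain a where KA: "indefinite_integral A (\<lambda>t. \<bar>f t\<bar>)" and
    limA: "(A \<longlongrightarrow> a) at_bot" "(A \<longlongrightarrow> a + integral UNIV (\<lambda>t. \<bar>f t\<bar>)) at_top"
    by (rule primitive_HK[OF HK_of_L1(2)[OF f] primA])
  have incr: "\<bar>F v - F u\<bar> \<le> A v - A u" if "u \<le> v" for u v
    using integral_norm_bound_integral[of f "{u..v}" "\<lambda>t. \<bar>f t\<bar>"]
      indefinite_integralD[OF KF that] indefinite_integralD[OF KA that]
    by (auto simp: has_integral_iff)
  have mono: "mono A"
  proof (rule monoI)
    fix u v :: real assume "u \<le> v"
    from incr[OF this] show "A u \<le> A v" by linarith
  qed
  have le: "A v - A u \<le> L1_norm f" if "u \<le> v" for u v
    using integral_subset_le[of "{u..v}" UNIV "\<lambda>t. \<bar>f t\<bar>"]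
      indefinite_integralD[OF KA that] HK_of_L1(2)[OF f]
    by (auto simp: has_integral_iff HK_def L1_norm_eq[OF f])
  have lim: "\<bar>A v - A u\<bar> \<le> L1_norm f" for u v
  proof (cases "u \<le> v")
    case True
    from le[OF True] monoD[OF mono True] show ?thesis by linarith
  next
    case False
    then have "v \<le> u" by simp
    from le[OF this] monoD[OF mono this] show ?thesis by linarith
  qed
  define w where "w = (\<lambda>y. translate x A y - A y)"
  define g where "g = (\<lambda>y. translate x F y - F y)"
  note * = isCont_indefinite_integral[OF KA] limA lim
  have w: "w \<in> HK" "alexiewicz_norm w \<le> L1_norm f * \<bar>x\<bar>"
    using translation_difference_HK[OF *] by (auto simp: w_def)
  have absw: "(\<lambda>y. \<bar>w y\<bar>) integrable_on UNIV" "integral UNIV (\<lambda>y. \<bar>w y\<bar>) = \<bar>integral UNIV w\<bar>"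
    using translation_difference_of_mono[OF mono] w(1) by (auto simp: w_def HK_def)
  have bound: "\<bar>g y\<bar> \<le> \<bar>w y\<bar>" for y
  proof (cases "0 \<le> x")
    case True
    with incr[of "y - x" y] show ?thesis unfolding g_def w_def translate_def by simp
  next
    case False
    with incr[of y "y - x"] show ?thesis unfolding g_def w_def translate_def by simp
  qed
  have "continuous_on UNIV F"
    using isCont_indefinite_integral[OF KF] by (simp add: continuous_at_imp_continuous_on)
  then have "continuous_on UNIV g"
    unfolding g_def translate_def
    by (intro continuous_intros continuous_on_compose2[of UNIV F UNIV "\<lambda>y. y - x"]) auto
  then have "g \<in> borel_measurable (lebesgue_on UNIV)"
    by (intro continuous_imp_measurable_on_sets_lebesgue) auto
  then have g: "g absolutely_integrable_on UNIV"
    using bound by (intro measurable_bounded_by_integrable_imp_absolutely_integrable[OF _ _ absw(1)]) auto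
  show "(\<lambda>y. translate x F y - F y) \<in> L1"
    using g by (simp add: L1_iff_absolutely_integrable g_def)
  then have "L1_norm g = integral UNIV (\<lambda>y. \<bar>g y\<bar>)" by (simp add: L1_norm_eq g_def)
  also have "\<dots> \<le> integral UNIV (\<lambda>y. \<bar>w y\<bar>)"
    using g absw(1) bound by (intro integral_le) (auto simp: absolutely_integrable_on_def)
  also have "\<dots> \<le> L1_norm f * \<bar>x\<bar>"
    using integral_le_alexiewicz_norm[OF w(1) is_interval_univ] w(2) absw(2) by linarith
  finally show "L1_norm (\<lambda>y. translate x F y - F y) \<le> L1_norm f * \<bar>x\<bar>" by (simp add: g_def)
qed

section \<open>A translation difference that is not absolutely integrable\<close>

text \<open>This is the antiderivative of the primitive \<open>F\<close> in the counterexample; starting from it makes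
  the integrals of the translation difference explicit.  The factor \<open>cos (pi * y)\<close> changes sign
  under the unit shift, so that differences add up instead of cancelling.  The factor
  \<open>y / (1 + y\<^sup>2)\<close> decays like \<open>1 / y\<close>: fast enough for \<open>F\<close> to tend to \<open>0\<close>, too slowly for absolute
  integrability.\<close>
definition damped_cos :: "real \<Rightarrow> real" where
  "damped_cos y = cos (pi * y) * (y / (1 + y\<^sup>2))"

definition damped_cos_deriv :: "real \<Rightarrow> real" where
  "damped_cos_deriv y = - pi * sin (pi * y) * (y / (1 + y\<^sup>2)) + cos (pi * y) * ((1 - y\<^sup>2) / (1 + y\<^sup>2)\<^sup>2)"

lemma one_plus_square_pos: "1 + y\<^sup>2 > (0::real)"
  by (simp add: add_pos_nonneg)

lemma damped_cos_has_derivative: "(damped_cos has_real_derivative damped_cos_deriv t) (at t)"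
  and damped_cos_deriv_differentiable: "\<exists>d. (damped_cos_deriv has_real_derivative d) (at t)"
proof -
  have nz: "1 + t\<^sup>2 \<noteq> 0" using one_plus_square_pos[of t] by simp
  have sq: "((\<lambda>y. 1 + y\<^sup>2) has_real_derivative 2 * t) (at t)"
    "((\<lambda>y. 1 - y\<^sup>2) has_real_derivative - (2 * t)) (at t)"
    by (auto intro!: derivative_eq_intros)
  have sq2: "((\<lambda>y. (1 + y\<^sup>2)\<^sup>2) has_real_derivative 2 * (1 + t\<^sup>2) * (2 * t)) (at t)"
    using DERIV_power[OF sq(1), of 2] by (simp add: ac_simps)
  have cos: "((\<lambda>y. cos (pi * y)) has_real_derivative - pi * sin (pi * t)) (at t)"
    and sin: "((\<lambda>y. - pi * sin (pi * y)) has_real_derivative - pi * (cos (pi * t) * pi)) (at t)"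
    by (auto intro!: derivative_eq_intros)
  have h: "((\<lambda>y. y / (1 + y\<^sup>2)) has_real_derivative ((1 - t\<^sup>2) / (1 + t\<^sup>2)\<^sup>2)) (at t)"
    using DERIV_divide[OF DERIV_ident sq(1) nz] by (simp add: power2_eq_square)
  show "(damped_cos has_real_derivative damped_cos_deriv t) (at t)"
    using DERIV_mult[OF cos h] by (simp add: damped_cos_def[abs_def] damped_cos_deriv_def ac_simps)
  have "(1 + t\<^sup>2)\<^sup>2 \<noteq> 0" using nz by simp
  from DERIV_add[OF DERIV_mult[OF sin h] DERIV_mult[OF cos DERIV_divide[OF sq(2) sq2 this]]]
  show "\<exists>d. (damped_cos_deriv has_real_derivative d) (at t)"
    unfolding damped_cos_deriv_def[abs_def] by (rule exI)
qed

lemma abs_damped_cos_deriv_le: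
  assumes "y \<noteq> 0"
  shows "\<bar>damped_cos_deriv y\<bar> \<le> 5 / \<bar>y\<bar>"
proof -
  have p: "1 + y\<^sup>2 > 0" by (rule one_plus_square_pos)
  have "\<bar>pi * sin (pi * y)\<bar> \<le> 4"
    using mult_mono[of pi 4 "\<bar>sin (pi * y)\<bar>" 1] pi_less_4 by (simp add: abs_mult)
  moreover have "\<bar>y / (1 + y\<^sup>2)\<bar> \<le> 1 / \<bar>y\<bar>"
    using p assms by (simp add: abs_divide field_simps power2_eq_square)
  ultimately have 1: "\<bar>pi * sin (pi * y) * (y / (1 + y\<^sup>2))\<bar> \<le> 4 * (1 / \<bar>y\<bar>)"
    unfolding abs_mult[of "pi * sin (pi * y)"] by (intro mult_mono) auto
  have "\<bar>y\<bar> \<le> 1 + y\<^sup>2"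
    using zero_le_power2[of "\<bar>y\<bar> - 1"] unfolding power2_diff power2_abs by (simp add: algebra_simps)
  then have "1 / (1 + y\<^sup>2) \<le> 1 / \<bar>y\<bar>" using assms by (intro divide_left_mono) (auto simp: p)
  moreover have "\<bar>(1 - y\<^sup>2) / (1 + y\<^sup>2)\<^sup>2\<bar> \<le> 1 / (1 + y\<^sup>2)"
  proof -
    have "\<bar>1 - y\<^sup>2\<bar> \<le> 1 + y\<^sup>2" by (simp add: abs_le_iff)
    then have "\<bar>1 - y\<^sup>2\<bar> / (1 + y\<^sup>2)\<^sup>2 \<le> (1 + y\<^sup>2) / (1 + y\<^sup>2)\<^sup>2" by (rule divide_right_mono) simp
    then show ?thesis using p by (simp add: power2_eq_square[of "1 + y\<^sup>2"] abs_divide)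
  qed
  ultimately have "\<bar>(1 - y\<^sup>2) / (1 + y\<^sup>2)\<^sup>2\<bar> \<le> 1 / \<bar>y\<bar>" by linarith
  then have 2: "\<bar>cos (pi * y) * ((1 - y\<^sup>2) / (1 + y\<^sup>2)\<^sup>2)\<bar> \<le> 1 * (1 / \<bar>y\<bar>)"
    unfolding abs_mult[of "cos (pi * y)"] by (intro mult_mono) auto
  have "\<bar>damped_cos_deriv y\<bar> \<le> 4 * (1 / \<bar>y\<bar>) + 1 * (1 / \<bar>y\<bar>)"
    using order_trans[OF abs_triangle_ineq4 add_mono[OF 2 1]] unfolding damped_cos_deriv_def
    by (simp add: add.commute)
  then show ?thesis by simp
qed

lemma damped_cos_deriv_limit:
  assumes "G = at_bot \<or> G = at_top"
  shows "(damped_cos_deriv \<longlongrightarrow> 0) G"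
proof (rule Lim_null_comparison)
  have G: "G \<le> at_infinity"
    using assms at_top_le_at_infinity at_bot_le_at_infinity by blast
  have "\<forall>\<^sub>F y in at_infinity. norm (y::real) \<ge> 1"
    unfolding eventually_at_infinity by blast
  then have "\<forall>\<^sub>F y in G. norm (y::real) \<ge> 1" using G by (rule filter_leD[rotated])
  then show "\<forall>\<^sub>F y in G. norm (damped_cos_deriv y) \<le> norm (5 / y)"
    by (rule eventually_mono) (use abs_damped_cos_deriv_le in \<open>force simp: abs_divide\<close>)
  have "((\<lambda>y::real. 5 / y) \<longlongrightarrow> 0) at_infinity"
    by (intro tendsto_divide_0[OF tendsto_const] filterlim_ident)
  then have "((\<lambda>y::real. 5 / y) \<longlongrightarrow> 0) G" using G by (rule tendsto_mono[rotated])
  then show "((\<lambda>y. norm (5 / y)) \<longlongrightarrow> 0) G" by (rule tendsto_norm_zero)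
qed

text \<open>Since \<open>cos (pi * k)\<close> alternates along the integers, the four values reinforce each other: with
  \<open>h y = y / (1 + y\<^sup>2)\<close>, the integral of the translation difference over \<open>{k..k + 1}\<close> is
  \<open>2 * h k + h (k + 1) + h (k - 1)\<close> up to sign.  Taking \<open>k \<ge> 1\<close> makes all summands
  nonnegative.\<close>
lemma damped_cos_increment:
  "1 / (real (Suc n) + 1) \<le>
    \<bar>(damped_cos (real (Suc n) + 1 - 1) - damped_cos (real (Suc n) + 1)) - (damped_cos (real (Suc n) - 1) - damped_cos (real (Suc n)))\<bar>"
proof -
  define k where "k = real (Suc n)"
  have k: "k \<ge> 1" by (simp add: k_def)
  have c: "cos (pi * (k + 1)) = - cos (pi * k)" "cos (pi * (k - 1)) = - cos (pi * k)"
    by (simp_all add: distrib_left right_diff_distrib cos_diff)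
  have abs1: "\<bar>cos (pi * k)\<bar> = 1"
    using cos_npi2[of "Suc n"] unfolding k_def by (simp add: power_abs del: of_nat_Suc power_Suc)
  define h where "h y = y / (1 + y\<^sup>2)" for y :: real
  have damped: "damped_cos y = cos (pi * y) * h y" for y
    by (simp add: damped_cos_def h_def)
  have "(damped_cos (k + 1 - 1) - damped_cos (k + 1)) - (damped_cos (k - 1) - damped_cos k)
      = cos (pi * k) * (2 * h k + h (k + 1) + h (k - 1))"
    unfolding damped c by (simp add: algebra_simps)
  then have "\<bar>(damped_cos (k + 1 - 1) - damped_cos (k + 1)) - (damped_cos (k - 1) - damped_cos k)\<bar> = \<bar>2 * h k + h (k + 1) + h (k - 1)\<bar>"
    by (simp only: abs_mult abs1) simp
  moreover have "h (k + 1) \<ge> 0" "h (k - 1) \<ge> 0" "h k \<ge> 0" using k by (auto simp: h_def)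
  moreover have "h k \<ge> 1 / (k + 1)"
    using k one_plus_square_pos[of k] by (simp add: h_def field_simps power2_eq_square)
  ultimately have "1 / (k + 1) \<le> \<bar>(damped_cos (k + 1 - 1) - damped_cos (k + 1)) - (damped_cos (k - 1) - damped_cos k)\<bar>" by linarith
  then show ?thesis unfolding k_def .
qed

text \<open>The integrals over consecutive unit intervals are dominated by those of \<open>\<bar>g\<bar>\<close>, whose partial
  sums telescope to increments of a bounded function.\<close>
lemma increments_summable_of_L1:
  assumes g: "g \<in> L1" and W: "indefinite_integral W g"
  shows "summable (\<lambda>n. \<bar>W (real n + 1) - W (real n)\<bar>)"
proof (rule summableI_nonneg_bounded)
  obtain V where V: "indefinite_integral V (\<lambda>y. \<bar>g y\<bar>)"
    by (rule HK_indefinite_integral[OF HK_of_L1(2)[OF g]])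
  have step: "\<bar>W (real n + 1) - W (real n)\<bar> \<le> V (real (Suc n)) - V (real n)" for n
    using integral_norm_bound_integral[of g "{real n..real n + 1}" "\<lambda>t. \<bar>g t\<bar>"]
      indefinite_integralD[OF W, of "real n" "real n + 1"]
      indefinite_integralD[OF V, of "real n" "real n + 1"]
    by (auto simp: has_integral_iff add.commute)
  fix n
  have "(\<Sum>i<n. \<bar>W (real i + 1) - W (real i)\<bar>) \<le> (\<Sum>i<n. V (real (Suc i)) - V (real i))"
    by (intro sum_mono step)
  also have "\<dots> = V (real n) - V 0" by (subst sum_lessThan_telescope) simp
  also have "\<dots> \<le> alexiewicz_norm (\<lambda>y. \<bar>g y\<bar>)"
    using increment_le_alexiewicz_norm[OF V HK_of_L1(2)[OF g], of "real n" 0] by linarith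
  finally show "(\<Sum>i<n. \<bar>W (real i + 1) - W (real i)\<bar>) \<le> alexiewicz_norm (\<lambda>y. \<bar>g y\<bar>)" .
qed simp

lemma damped_cos_deriv_translation_difference_notin_L1:
  "(\<lambda>y. translate 1 damped_cos_deriv y - damped_cos_deriv y) \<notin> L1"
proof
  define W where "W t = damped_cos (t - 1) - damped_cos t" for t
  have "((\<lambda>s. damped_cos (s - 1)) has_real_derivative damped_cos_deriv (t - 1)) (at t)" for t
    using DERIV_shift[of damped_cos "damped_cos_deriv (t - 1)" t "- 1"] damped_cos_has_derivative[of "t - 1"] by simp
  then have W: "indefinite_integral W (\<lambda>y. translate 1 damped_cos_deriv y - damped_cos_deriv y)"
    unfolding W_def translate_def
    by (intro indefinite_integral_antiderivative DERIV_diff damped_cos_has_derivative)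
  assume "(\<lambda>y. translate 1 damped_cos_deriv y - damped_cos_deriv y) \<in> L1"
  from increments_summable_of_L1[OF this W]
  have "summable (\<lambda>n. \<bar>W (real (Suc n) + 1) - W (real (Suc n))\<bar>)"
    by (subst summable_Suc_iff)
  then have "summable (\<lambda>n. 1 / (real (Suc n) + 1))"
    by (rule summable_comparison_test'[where N = 0]) (use damped_cos_increment in \<open>simp add: W_def\<close>)
  then have "summable (\<lambda>n. inverse (real (Suc (Suc n))))"
    by (simp add: inverse_eq_divide add.commute)
  then show False
    using not_summable_harmonic[where 'a=real] by (simp only: summable_Suc_iff[of "\<lambda>n. inverse (real n)"] summable_Suc_iff[of "\<lambda>n. inverse (real (Suc n))"])
qed

lemma ex_translation_difference_notin_L1:
  "\<exists>f\<in>HK. \<exists>F x. primitive_of F f \<and> (\<lambda>y. translate x F y - F y) \<notin> L1"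
proof -
  obtain f where f: "\<And>t. (damped_cos_deriv has_real_derivative f t) (at t)"
    using damped_cos_deriv_differentiable by metis
  have K: "indefinite_integral damped_cos_deriv f" by (rule indefinite_integral_antiderivative[OF f])
  have "(f has_integral 0 - 0) UNIV"
    by (intro has_integral_UNIV_of_limits[OF K] damped_cos_deriv_limit) auto
  then have "f \<in> HK" by (auto simp: HK_def has_integral_integrable)
  moreover have "primitive_of damped_cos_deriv f"
    by (rule primitive_of_indefinite_integral[OF K damped_cos_deriv_limit]) simp
  ultimately show ?thesis using damped_cos_deriv_translation_difference_notin_L1 by blast
qed

theorem theorem4:
  "(\<forall>f\<in>HK. \<forall>F x. primitive_of F f \<longrightarrow>
      (\<lambda>y. translate x F y - F y) \<in> HK \<and>
      alexiewicz_norm (\<lambda>y. translate x F y - F y) \<le> alexiewicz_norm f * \<bar>x\<bar>) \<and>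
   (\<exists>f\<in>HK. \<forall>F. primitive_of F f \<longrightarrow> F \<notin> HK) \<and>
   (\<exists>f\<in>HK. \<exists>F x. primitive_of F f \<and> (\<lambda>y. translate x F y - F y) \<notin> L1) \<and>
   (\<forall>f\<in>L1. \<forall>F x. primitive_of F f \<longrightarrow>
      (\<lambda>y. translate x F y - F y) \<in> L1 \<and>
      L1_norm (\<lambda>y. translate x F y - F y) \<le> L1_norm f * \<bar>x\<bar>)"
proof (intro conjI ballI allI impI)
  show "\<exists>f\<in>HK. \<forall>F. primitive_of F f \<longrightarrow> F \<notin> HK"
    using primitive_notin_HK[OF indicator_unit_interval(1)] indicator_unit_interval
    by (intro bexI[of _ "indicator {0..1}"]) auto
qed (use translation_difference_of_primitive ex_translation_difference_notin_L1
       translation_difference_of_L1_primitive in blast)+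

end
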